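(* Let $n$, $m$, $\mu$, $\lambda$ and $k$ be positive integers with $\mu>\lambda$ and $m\ge n-2$. Then a path decomposition $\mathcal{A}$ of $\lambda K_n$ of size $k$ can be enclosed in a $2$-factorization of $\mu K_{n+m}$ if and only if all of the following hold: (N1) $k=\frac{\mu(m+n-1)}{2}$; (N2) the number of colour classes of $\mathcal{A}$ that are $2$-factors of $\lambda K_n$ is at most $\frac{\mu(m-1)}{2}$; (N3) $\sum_{i=0}^{n-m}(n-m-i)\,|\mathcal{S}_i(\mathcal{A})|\le(\mu-\lambda)\frac{n(n-1)}{2}$ (an empty sum is $0$).
   Context: Graphs may have multiple edges. For a positive integer $\lambda$, $\lambda K_n$ is the loopless multigraph on $n$ vertices in which every pair of distinct vertices is joined by exactly $\lambda$ edges. A decomposition of size $k$ of a graph $G$ is an ordered $k$-tuple $(G(1),\dots,G(k))$ of spanning subgraphs of $G$ (called colour classes; a colour class may have no edges) whose edge sets are pairwise disjoint with union $E(G)$. A path decomposition is a decomposition in which every colour class is a vertex-disjoint union of paths and cycles (isolated vertices count as trivial paths; two parallel edges form a cycle of length 2). A $2$-factor of a graph is a $2$-regular spanning subgraph; a $2$-factorization is a decomposition in which every colour class is a $2$-factor. For $\mu>\lambda$, a decomposition $(G(1),\dots,G(k))$ of $\lambda K_n$ is enclosed in a decomposition $(H(1),\dots,H(k))$ of $\mu K_{n+m}$ (where $\lambda K_n$ is regarded as a subgraph of $\mu K_{n+m}$ on $n$ of its vertices) if $G(i)\subseteq H(i)$ for every $i$. For a decomposition $\mathcal{A}$, $\mathcal{S}_i(\mathcal{A})$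 is the set of colour classes of $\mathcal{A}$ with exactly $i$ edges. *)

theory Defs
  imports Complex_Main
begin

text \<open>A loopless multigraph on a vertex set V (vertices are naturals) is represented by
  its symmetric edge-multiplicity function: H u v is the number of edges joining u and v.\<close>
definition multigraph_on :: "nat set \<Rightarrow> (nat \<Rightarrow> nat \<Rightarrow> nat) \<Rightarrow> bool" where
  "multigraph_on V H \<longleftrightarrow> (\<forall>u v. H u v = H v u) \<and> (\<forall>u. H u u = 0)
     \<and> (\<forall>u v. (u \<notin> V \<or> v \<notin> V) \<longrightarrow> H u v = 0)"

definition decomposition :: "nat \<Rightarrow> nat \<Rightarrow> nat \<Rightarrow> (nat \<Rightarrow> nat \<Rightarrow> nat \<Rightarrow> nat) \<Rightarrow> bool" where
  "decomposition lam n k G \<longleftrightarrow> (\<forall>i<k. multigraph_on {..<n} (G i))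
     \<and> (\<forall>u<n. \<forall>v<n. u \<noteq> v \<longrightarrow> (\<Sum>i<k. G i u v) = lam)"

text \<open>Edge multiplicities of a path with vertex sequence ps, and of a cycle with cyclic
  vertex sequence cs (a cycle on two vertices consists of two parallel edges).\<close>
definition path_mult :: "nat list \<Rightarrow> nat \<Rightarrow> nat \<Rightarrow> nat" where
  "path_mult ps u v = card {i. Suc i < length ps \<and> {ps ! i, ps ! Suc i} = {u, v}}"

definition cycle_mult :: "nat list \<Rightarrow> nat \<Rightarrow> nat \<Rightarrow> nat" where
  "cycle_mult cs u v =
     card {i. i < length cs \<and> {cs ! i, cs ! (Suc i mod length cs)} = {u, v}}"

definition comp_mult :: "bool \<times> nat list \<Rightarrow> nat \<Rightarrow> nat \<Rightarrow> nat" where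
  "comp_mult c u v = (if fst c then cycle_mult (snd c) u v else path_mult (snd c) u v)"

text \<open>H is a vertex-disjoint union of paths and cycles covering V
  (isolated vertices are trivial paths).\<close>
definition path_cycle_union :: "nat set \<Rightarrow> (nat \<Rightarrow> nat \<Rightarrow> nat) \<Rightarrow> bool" where
  "path_cycle_union V H \<longleftrightarrow> (\<exists>Cs :: (bool \<times> nat list) list.
      distinct (concat (map snd Cs)) \<and> set (concat (map snd Cs)) = V
    \<and> (\<forall>c\<in>set Cs. snd c \<noteq> [] \<and> (fst c \<longrightarrow> length (snd c) \<ge> 2))
    \<and> (\<forall>u v. H u v = (\<Sum>c\<leftarrow>Cs. comp_mult c u v)))"

definition path_decomposition :: "nat \<Rightarrow> nat \<Rightarrow> nat \<Rightarrow> (nat \<Rightarrow> nat \<Rightarrow> nat \<Rightarrow> nat) \<Rightarrow> bool" where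
  "path_decomposition lam n k G \<longleftrightarrow> decomposition lam n k G
     \<and> (\<forall>i<k. path_cycle_union {..<n} (G i))"

definition degree :: "nat set \<Rightarrow> (nat \<Rightarrow> nat \<Rightarrow> nat) \<Rightarrow> nat \<Rightarrow> nat" where
  "degree V H u = (\<Sum>v\<in>V. H u v)"

definition two_factor :: "nat set \<Rightarrow> (nat \<Rightarrow> nat \<Rightarrow> nat) \<Rightarrow> bool" where
  "two_factor V H \<longleftrightarrow> multigraph_on V H \<and> (\<forall>u\<in>V. degree V H u = 2)"

definition two_factorization :: "nat \<Rightarrow> nat \<Rightarrow> nat \<Rightarrow> (nat \<Rightarrow> nat \<Rightarrow> nat \<Rightarrow> nat) \<Rightarrow> bool" where
  "two_factorization mu N k H \<longleftrightarrow> decomposition mu N k H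
     \<and> (\<forall>i<k. two_factor {..<N} (H i))"

definition enclosed_in :: "nat \<Rightarrow> (nat \<Rightarrow> nat \<Rightarrow> nat \<Rightarrow> nat) \<Rightarrow> (nat \<Rightarrow> nat \<Rightarrow> nat \<Rightarrow> nat) \<Rightarrow> bool" where
  "enclosed_in k G H \<longleftrightarrow> (\<forall>i<k. \<forall>u v. G i u v \<le> H i u v)"

definition num_edges :: "nat \<Rightarrow> (nat \<Rightarrow> nat \<Rightarrow> nat) \<Rightarrow> nat" where
  "num_edges n H = (\<Sum>u<n. \<Sum>v<n. if u < v then H u v else 0)"

definition S_classes :: "nat \<Rightarrow> nat \<Rightarrow> (nat \<Rightarrow> nat \<Rightarrow> nat \<Rightarrow> nat) \<Rightarrow> nat \<Rightarrow> nat set" where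
  "S_classes n k G i = {j. j < k \<and> num_edges n (G j) = i}"

end

theory Submission
  imports Defs
begin

text \<open>Necessity is edge counting. For sufficiency, first distribute the \<open>mu - lam\<close> additional copies of
  \<open>K_n\<close> over the classes, keeping all degrees at most 2 and serving classes with fewer than \<open>n - m\<close>
  edges first; as \<open>n - m \<le> 2\<close>, such a class accepts any edge. If no class accepted an edge \<open>ab\<close>, every
  class \<open>i\<close> would satisfy \<open>deg a + deg b \<ge> 2 + (multiplicity of ab in class i)\<close>, and summing over \<open>i\<close>
  contradicts \<open>2k = mu (n + m - 1) \<ge> mu (2n - 3)\<close>.
  The resulting decomposition of \<open>mu K_n\<close> is then extended one vertex at a time. With \<open>N = n + m\<close>,
  the invariant is that each class of \<open>mu K_r\<close> has at least \<open>2r - N\<close> edges. The edges at the new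
  vertex form an integral version of \<open>1 / (N - r)\<close> times the bipartite multigraph of missing degrees
  between classes and vertices, and Hall's theorem provides it.\<close>

section \<open>Hall's theorem with capacities\<close>

text \<open>Induction on \<open>card L\<close>. If some nonempty proper subset of \<open>L\<close>
  is tight in Hall's condition, it is assigned first and the rest avoids its neighbourhood.
  Otherwise every such subset has slack, and one element can be assigned greedily.\<close>

lemma hall_capacities:
  fixes N :: "'a \<Rightarrow> 'b set" and b :: "'b \<Rightarrow> nat"
  assumes "finite L" "\<And>l. l \<in> L \<Longrightarrow> finite (N l)"
    and "\<And>S. S \<subseteq> L \<Longrightarrow> card S \<le> sum b (\<Union>(N ` S))"
  shows "\<exists>f. (\<forall>l\<in>L. f l \<in> N l) \<and> (\<forall>j. card {l \<in> L. f l = j} \<le> b j)"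
  using assms
proof (induction "card L" arbitrary: L b rule: less_induct)
  case less
  note fin = less.prems(1) and finN = less.prems(2) and hall = less.prems(3)
  have finNS: "finite (\<Union>(N ` S))" if "S \<subseteq> L" for S
    using that fin finN by (meson finite_UN_I finite_subset subsetD)
  show ?case
  proof (cases "\<exists>S. S \<noteq> {} \<and> S \<subset> L \<and> card S = sum b (\<Union>(N ` S))")
    case True
    then obtain S where S: "S \<noteq> {}" "S \<subset> L" "card S = sum b (\<Union>(N ` S))" by blast
    have finS: "finite S" using S(2) fin finite_subset by blast
    define M where "M = \<Union>(N ` S)"
    \<comment> \<open>Tightness means that assigning \<open>S\<close> uses up the whole capacity of
      \<open>M\<close>, so none of it is left for \<open>L - S\<close>.\<close>
    define b' where "b' j = (if j \<in> M then 0 else b j)" for j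
    have "card S < card L" using S(2) fin by (simp add: psubset_card_mono)
    then obtain f where f: "\<forall>l\<in>S. f l \<in> N l" "\<forall>j. card {l \<in> S. f l = j} \<le> b j"
      using less.hyps[of S b] finS finN hall S(2) by (metis psubset_imp_subset subsetD subset_trans)
    have less1: "card (L - S) < card L" using S fin finS
      by (metis Diff_subset Diff_eq_empty_iff double_diff psubsetE psubsetI psubset_card_mono Diff_empty)
    have hall1: "card T \<le> sum b' (\<Union>(N ` T))" if T: "T \<subseteq> L - S" for T
    proof -
      have TL: "T \<subseteq> L" "finite T" using T fin finite_subset by auto
      have "card T + card S = card (T \<union> S)"
        using T TL finS by (subst card_Un_disjoint) auto
      also have "\<dots> \<le> sum b (\<Union>(N ` (T \<union> S)))" using hall[of "T \<union> S"] TL(1) S(2) by blast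
      also have "\<Union>(N ` (T \<union> S)) = (\<Union>(N ` T) - M) \<union> M" by (auto simp: M_def)
      also have "sum b \<dots> = sum b (\<Union>(N ` T) - M) + sum b M"
        using finNS[OF TL(1)] finNS[of S] S(2) by (intro sum.union_disjoint) (auto simp: M_def)
      also have "sum b (\<Union>(N ` T) - M) = sum b' (\<Union>(N ` T))"
        using finNS[OF TL(1)] by (intro sum.mono_neutral_cong_left) (auto simp: b'_def)
      finally show ?thesis using S(3) by (simp add: M_def)
    qed
    obtain g where g: "\<forall>l\<in>L - S. g l \<in> N l" "\<forall>j. card {l \<in> L - S. g l = j} \<le> b' j"
      using less.hyps[OF less1 _ _ hall1] fin finN by blast
    define h where "h l = (if l \<in> S then f l else g l)" for l
    have "card {l \<in> L. h l = j} \<le> b j" for j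
    proof -
      have eq: "{l \<in> L. h l = j} = {l \<in> S. f l = j} \<union> {l \<in> L - S. g l = j}"
        using S(2) by (auto simp: h_def)
      show ?thesis
      proof (cases "j \<in> M")
        case True
        then have "{l \<in> L - S. g l = j} = {}"
          using g(2)[rule_format, of j] fin by (simp add: b'_def)
        then show ?thesis using f(2) by (simp only: eq Un_empty_right)
      next
        case False
        then have "{l \<in> S. f l = j} = {}" using f(1) by (auto simp: M_def)
        then have "card {l \<in> L. h l = j} \<le> b' j"
          using g(2) by (simp only: eq Un_empty_left)
        then show ?thesis using False by (simp add: b'_def)
      qed
    qed
    moreover have "\<forall>l\<in>L. h l \<in> N l" using f g by (auto simp: h_def)
    ultimately show ?thesis by blast
  next
    case False
    show ?thesis
    proof (cases "L = {}")
      case True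
      then show ?thesis by auto
    next
      case nonempty: False
      then obtain l where l: "l \<in> L" by blast
      have "1 \<le> sum b (N l)" using hall[of "{l}"] l by simp
      then obtain j where j: "j \<in> N l" "b j > 0"
        by (metis gr0I not_one_le_zero sum.neutral)
      define b' where "b' = b(j := b j - 1)"
      have less1: "card (L - {l}) < card L" using fin l by (rule card_Diff1_less)
      have hall1: "card S \<le> sum b' (\<Union>(N ` S))" if S: "S \<subseteq> L - {l}" for S
      proof (cases "S = {}")
        case False
        have fS: "finite (\<Union>(N ` S))" using S finNS by blast
        \<comment> \<open>Such an \<open>S\<close> omits \<open>l\<close>, so it is a proper subset
          and not tight; its slack pays for the unit of capacity taken at \<open>j\<close>.\<close>
        have "card S < sum b (\<Union>(N ` S))"
          using False \<open>\<not> (\<exists>S. S \<noteq> {} \<and> S \<subset> L \<and> _ S)\<close> S l hall[of S]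
          by (metis Diff_empty le_neq_implies_less psubsetI subset_Diff_insert)
        also have "sum b (\<Union>(N ` S)) \<le> sum b' (\<Union>(N ` S)) + 1"
        proof -
          have "sum b (\<Union>(N ` S)) \<le> (\<Sum>i\<in>\<Union>(N ` S). b' i + (if i = j then 1 else 0))"
            by (intro sum_mono) (auto simp: b'_def)
          also have "\<dots> \<le> sum b' (\<Union>(N ` S)) + 1"
            using fS by (simp add: sum.distrib)
          finally show ?thesis .
        qed
        finally show ?thesis by simp
      qed simp
      obtain f where f: "\<forall>l'\<in>L - {l}. f l' \<in> N l'"
          "\<forall>j. card {l' \<in> L - {l}. f l' = j} \<le> b' j"
        using less.hyps[OF less1 _ _ hall1] fin finN by blast
      have "card {l' \<in> L. (f(l := j)) l' = i} \<le> b i" for i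
      proof (cases "i = j")
        case True
        then have "{l' \<in> L. (f(l := j)) l' = i} = insert l {l' \<in> L - {l}. f l' = j}"
          using l by auto
        then have "card {l' \<in> L. (f(l := j)) l' = i} \<le> Suc (card {l' \<in> L - {l}. f l' = j})"
          by (simp add: card_insert_le_m1 fin card_insert_if)
        then show ?thesis using f(2)[rule_format, of j] j True by (simp add: b'_def)
      next
        case False
        then have "{l' \<in> L. (f(l := j)) l' = i} = {l' \<in> L - {l}. f l' = i}" by auto
        then show ?thesis using f(2)[rule_format, of i] False by (simp add: b'_def)
      qed
      moreover have "\<forall>l'\<in>L. (f(l := j)) l' \<in> N l'" using f j by auto
      ultimately show ?thesis by blast
    qed
  qed
qed

section \<open>Integral rounding of nonnegative matrices\<close>

text \<open>\<open>c / q\<close> is a fractional assignment that meets every \<open>b j\<close>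
  exactly, whence Hall's condition: the rows in \<open>S\<close> have total
  \<open>q * card S\<close>, all of it in neighbouring columns, and column \<open>j\<close> has
  total \<open>q * b j\<close>.\<close>

lemma regular_assignment:
  fixes c :: "'a \<Rightarrow> 'b \<Rightarrow> nat"
  assumes fin: "finite L" "finite J" and q: "q > 0"
    and row: "\<And>l. l \<in> L \<Longrightarrow> (\<Sum>j\<in>J. c l j) = q"
    and col: "\<And>j. j \<in> J \<Longrightarrow> (\<Sum>l\<in>L. c l j) = q * b j"
  shows "\<exists>f. (\<forall>l\<in>L. f l \<in> J \<and> c l (f l) > 0) \<and> (\<forall>j\<in>J. card {l \<in> L. f l = j} = b j)"
proof -
  define N where "N l = {j \<in> J. c l j > 0}" for l
  have hall: "card S \<le> sum b (\<Union>(N ` S))" if S: "S \<subseteq> L" for S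
  proof -
    have sub: "\<Union>(N ` S) \<subseteq> J" by (auto simp: N_def)
    have "q * card S = (\<Sum>l\<in>S. \<Sum>j\<in>J. c l j)" using row S by (simp add: subset_iff)
    also have "\<dots> = (\<Sum>l\<in>S. \<Sum>j\<in>\<Union>(N ` S). c l j)"
      using fin(2) sub by (intro sum.cong refl sum.mono_neutral_right) (auto simp: N_def)
    also have "\<dots> \<le> (\<Sum>l\<in>L. \<Sum>j\<in>\<Union>(N ` S). c l j)"
      using fin S by (intro sum_mono2) auto
    also have "\<dots> = (\<Sum>j\<in>\<Union>(N ` S). \<Sum>l\<in>L. c l j)" by (rule sum.swap)
    also have "\<dots> = (\<Sum>j\<in>\<Union>(N ` S). q * b j)"
      using sub by (intro sum.cong refl col) blast
    also have "\<dots> = q * sum b (\<Union>(N ` S))" by (simp add: sum_distrib_left)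
    finally show ?thesis using q by simp
  qed
  obtain f where f: "\<forall>l\<in>L. f l \<in> N l" "\<forall>j. card {l \<in> L. f l = j} \<le> b j"
    using hall_capacities[OF fin(1) _ hall] fin(2) unfolding N_def by auto
  \<comment> \<open>Summing \<open>c\<close> by rows and by columns gives
    \<open>card L = sum b J\<close>, so the assignment fills every capacity.\<close>
  have "q * card L = q * sum b J"
  proof -
    have "q * card L = (\<Sum>l\<in>L. \<Sum>j\<in>J. c l j)" using row by simp
    also have "\<dots> = (\<Sum>j\<in>J. \<Sum>l\<in>L. c l j)" by (rule sum.swap)
    also have "\<dots> = q * sum b J" using col by (simp add: sum_distrib_left)
    finally show ?thesis .
  qed
  then have "card L = sum b J" using q by simp
  moreover have "(\<Sum>j\<in>J. card {l \<in> L. f l = j}) = card L"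
  proof -
    have "(\<Sum>j\<in>J. \<Sum>l\<in>{l \<in> L. f l = j}. 1) = (\<Sum>l\<in>L. 1::nat)"
      using fin f(1) by (intro sum.group) (auto simp: N_def)
    then show ?thesis by simp
  qed
  ultimately have eq: "(\<Sum>j\<in>J. card {l \<in> L. f l = j}) = sum b J" by simp
  have "card {l \<in> L. f l = j} = b j" if "j \<in> J" for j
    using sum_mono_inv[OF eq _ that fin(2)] f(2) by simp
  then show ?thesis using f(1) by (auto simp: N_def)
qed

lemma exists_subfunction_sum:
  fixes c :: "'a \<Rightarrow> nat"
  assumes "finite J" "s \<le> sum c J"
  shows "\<exists>c'. (\<forall>j. c' j \<le> c j) \<and> sum c' J = s"
  using assms
proof (induction J arbitrary: s rule: finite_induct)
  case empty
  then show ?case by (intro exI[of _ "\<lambda>_. 0"]) simp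
next
  case (insert x F)
  have "s - min s (c x) \<le> sum c F" using insert by simp
  then obtain c' where c': "\<forall>j. c' j \<le> c j" "sum c' F = s - min s (c x)"
    using insert.IH by blast
  have "sum (c'(x := min s (c x))) F = sum c' F" using insert by (intro sum.cong) auto
  then show ?case using insert c' by (intro exI[of _ "c'(x := min s (c x))"]) auto
qed

text \<open>Each row is cut into two rows of sum \<open>q\<close>, with the entry in column \<open>w\<close> put into the
  first half as far as possible; an entry not exceeding 1 then lies in one half only, and so
  does the one in column \<open>w\<close> if it does not exceed \<open>q\<close>.\<close>
lemma two_regular_submatrix:
  fixes c :: "nat \<Rightarrow> 'b \<Rightarrow> nat"
  assumes J: "finite J" and q: "q > 0" and w: "w \<in> J"
    and row: "\<And>i. i < k \<Longrightarrow> (\<Sum>j\<in>J. c i j) = 2 * q"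
    and col: "\<And>j. j \<in> J \<Longrightarrow> (\<Sum>i<k. c i j) = q * b j"
  shows "\<exists>x. (\<forall>i<k. (\<Sum>j\<in>J. x i j) = 2) \<and> (\<forall>j\<in>J. (\<Sum>i<k. x i j) = b j)
    \<and> (\<forall>i<k. \<forall>j\<in>J. x i j \<le> c i j) \<and> (\<forall>i<k. c i w \<le> q \<longrightarrow> x i w \<le> (1::nat))"
proof -
  have "\<exists>c'. (\<forall>j. c' j \<le> c i j) \<and> sum c' J = q \<and> c' w = min q (c i w)" if i: "i < k" for i
  proof -
    have J': "J = insert w (J - {w})" "w \<notin> J - {w}" "finite (J - {w})" using w J by auto
    have "c i w + sum (c i) (J - {w}) = 2 * q"
      using row[OF i] sum.remove[OF J w, of "c i"] by simp
    then have "q - min q (c i w) \<le> sum (c i) (J - {w})" by simp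
    then obtain c' where c': "\<forall>j. c' j \<le> c i j" "sum c' (J - {w}) = q - min q (c i w)"
      using exists_subfunction_sum[OF J'(3)] by blast
    have "sum (c'(w := min q (c i w))) (J - {w}) = sum c' (J - {w})" by (intro sum.cong) auto
    then have "sum (c'(w := min q (c i w))) J = q"
      using c' by (subst sum.remove[OF J w]) simp
    then show ?thesis using c' by (intro exI[of _ "c'(w := min q (c i w))"]) auto
  qed
  then obtain h where h: "\<And>i j. i < k \<Longrightarrow> h i j \<le> c i j" "\<And>i. i < k \<Longrightarrow> sum (h i) J = q"
      "\<And>i. i < k \<Longrightarrow> h i w = min q (c i w)"
    by metis
  \<comment> \<open>Row \<open>i\<close> is doubled: \<open>(i, True)\<close> carries
    \<open>h i\<close> and \<open>(i, False)\<close> the remainder, each with sum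
    \<open>q\<close>.\<close>
  define c2 where "c2 = (\<lambda>(i, s) j. if s then h i j else c i j - h i j)"
  let ?L = "{..<k} \<times> (UNIV :: bool set)"
  have sumL: "(\<Sum>l\<in>?L. g l) = (\<Sum>i<k. g (i, True) + g (i, False))" for g :: "nat \<times> bool \<Rightarrow> nat"
    by (subst sum.cartesian_product') (simp add: UNIV_bool add.commute)
  have "(\<Sum>j\<in>J. c2 l j) = q" if lL: "l \<in> ?L" for l
  proof -
    obtain i s where l: "l = (i, s)" "i < k" using lL by auto
    show ?thesis using l h(1,2)[OF l(2)] row[OF l(2)]
      by (cases s) (simp_all add: c2_def sum_subtractf_nat)
  qed
  moreover have "(\<Sum>l\<in>?L. c2 l j) = q * b j" if "j \<in> J" for j
    unfolding sumL using col[OF that] h(1) by (simp add: c2_def)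
  ultimately have "\<exists>f. (\<forall>l\<in>?L. f l \<in> J \<and> c2 l (f l) > 0) \<and> (\<forall>j\<in>J. card {l \<in> ?L. f l = j} = b j)"
    using J q by (intro regular_assignment) auto
  then obtain f where f: "\<forall>l\<in>?L. f l \<in> J \<and> c2 l (f l) > 0" "\<forall>j\<in>J. card {l \<in> ?L. f l = j} = b j"
    by blast
  define x where "x i j = (if f (i, True) = j then 1 else 0) + (if f (i, False) = j then 1 else (0::nat))" for i j
  have "(\<Sum>j\<in>J. x i j) = 2" if "i < k" for i
    using J f(1)[rule_format, of "(i, True)"] f(1)[rule_format, of "(i, False)"] that by (simp add: x_def sum.distrib)
  moreover have "(\<Sum>i<k. x i j) = b j" if "j \<in> J" for j
  proof -
    have "card {l \<in> ?L. f l = j} = (\<Sum>l\<in>?L. if f l = j then 1 else 0)"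
      by (subst sum.inter_filter[symmetric]) auto
    then show ?thesis using f(2)[rule_format, OF that] by (simp only: sumL x_def)
  qed
  \<comment> \<open>If both halves of row \<open>i\<close> choose \<open>j\<close>, both are
    positive there, so \<open>c i j\<close> is at least 2.\<close>
  moreover have "x i j \<le> c i j" if i: "i < k" "j \<in> J" for i j
    using f(1)[rule_format, of "(i, True)"] f(1)[rule_format, of "(i, False)"] h(1)[OF i(1), of j] i
    by (auto simp: x_def c2_def)
  \<comment> \<open>Here \<open>h i w = c i w\<close>, so the second half is 0 in column
    \<open>w\<close> and cannot choose it.\<close>
  moreover have "x i w \<le> 1" if i: "i < k" "c i w \<le> q" for i
    using f(1)[rule_format, of "(i, False)"] h(3)[OF i(1)] i by (auto simp: x_def c2_def)
  ultimately show ?thesis by (intro exI[of _ x]) auto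
qed

section \<open>Counting edges\<close>

lemma multigraph_on_sym: "multigraph_on V H \<Longrightarrow> H u v = H v u"
  by (simp add: multigraph_on_def)

lemma multigraph_on_loop: "multigraph_on V H \<Longrightarrow> H u u = 0"
  by (simp add: multigraph_on_def)

lemma sum_degrees:
  assumes "multigraph_on V H"
  shows "(\<Sum>u<n. degree {..<n} H u) = 2 * num_edges n H"
proof -
  let ?g = "\<lambda>u v. if u < v then H u v else 0"
  have "(\<Sum>u<n. \<Sum>v<n. H u v) = (\<Sum>u<n. \<Sum>v<n. ?g u v + ?g v u)"
    using assms unfolding multigraph_on_def
    by (intro sum.cong refl) (metis add.left_neutral add.right_neutral not_less_iff_gr_or_eq)
  also have "\<dots> = (\<Sum>u<n. \<Sum>v<n. ?g u v) + (\<Sum>u<n. \<Sum>v<n. ?g v u)"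
    by (simp add: sum.distrib)
  also have "(\<Sum>u<n. \<Sum>v<n. ?g v u) = (\<Sum>u<n. \<Sum>v<n. ?g u v)" by (rule sum.swap)
  finally show ?thesis by (simp add: num_edges_def degree_def)
qed

text \<open>Every edge at \<open>u\<close> counts again in the degree of its other end, so twice the
  degree of \<open>u\<close> is at most the degree sum.\<close>

lemma degree_le_num_edges:
  assumes H: "multigraph_on V H" and u: "u < n"
  shows "degree {..<n} H u \<le> num_edges n H"
proof -
  have "degree {..<n} H u = (\<Sum>w\<in>{..<n} - {u}. H w u)"
    using H u unfolding degree_def multigraph_on_def by (subst sum.remove[of _ u]) auto
  also have "\<dots> \<le> (\<Sum>w\<in>{..<n} - {u}. degree {..<n} H w)"
    unfolding degree_def using u by (intro sum_mono member_le_sum) auto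
  finally have "2 * degree {..<n} H u \<le> (\<Sum>w<n. degree {..<n} H w)"
    using u by (subst sum.remove[of _ u]) auto
  then show ?thesis using sum_degrees[OF H, of n] by simp
qed

lemma mult_le_degree: "v < n \<Longrightarrow> H u v \<le> degree {..<n} H u"
  unfolding degree_def by (intro member_le_sum) auto

lemma num_edges_mono:
  assumes "\<And>u v. H u v \<le> H' u v" shows "num_edges n H \<le> num_edges n H'"
  unfolding num_edges_def using assms by (intro sum_mono) auto

lemma num_edges_cong:
  assumes "\<And>u v. u < v \<Longrightarrow> v < n \<Longrightarrow> H u v = H' u v" shows "num_edges n H = num_edges n H'"
  unfolding num_edges_def using assms by (intro sum.cong) auto

lemma num_edges_sum: "num_edges n (\<lambda>u v. \<Sum>i<k. G i u v) = (\<Sum>i<k. num_edges n (G i))"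
proof -
  have "num_edges n (\<lambda>u v. \<Sum>i<k. G i u v)
      = (\<Sum>u<n. \<Sum>v<n. \<Sum>i<k. if u < v then G i u v else 0)"
    unfolding num_edges_def by (intro sum.cong refl) simp
  also have "\<dots> = (\<Sum>u<n. \<Sum>i<k. \<Sum>v<n. if u < v then G i u v else 0)"
    by (intro sum.cong refl sum.swap)
  also have "\<dots> = (\<Sum>i<k. num_edges n (G i))"
    unfolding num_edges_def by (rule sum.swap)
  finally show ?thesis .
qed

lemma num_edges_Suc: "num_edges (Suc n) H = num_edges n H + (\<Sum>u<n. H u n)"
  by (simp add: num_edges_def sum.distrib)

lemma num_edges_const: "2 * num_edges n (\<lambda>u v. c) = c * (n * (n - 1))"
proof (induction n)
  case 0
  then show ?case by (simp add: num_edges_def)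
next
  case (Suc n)
  then show ?case by (cases n) (simp_all add: num_edges_Suc algebra_simps)
qed

lemma num_edges_decomposition:
  assumes "decomposition lam n k G"
  shows "2 * (\<Sum>i<k. num_edges n (G i)) = lam * (n * (n - 1))"
proof -
  have "num_edges n (\<lambda>u v. \<Sum>i<k. G i u v) = num_edges n (\<lambda>u v. lam)"
    using assms unfolding decomposition_def by (intro num_edges_cong) auto
  then show ?thesis using num_edges_const[of n lam] by (simp add: num_edges_sum)
qed

lemma sum_degree_decomposition:
  assumes "decomposition lam n k G" "u < n"
  shows "(\<Sum>i<k. degree {..<n} (G i) u) = lam * (n - 1)"
proof -
  have "(\<Sum>i<k. degree {..<n} (G i) u) = (\<Sum>v<n. \<Sum>i<k. G i u v)"
    unfolding degree_def by (rule sum.swap)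
  also have "\<dots> = (\<Sum>v\<in>{..<n} - {u}. \<Sum>i<k. G i u v)"
    using assms by (subst sum.remove[of _ u]) (auto simp: decomposition_def multigraph_on_def)
  also have "\<dots> = (\<Sum>v\<in>{..<n} - {u}. lam)"
    using assms by (intro sum.cong refl) (auto simp: decomposition_def)
  finally show ?thesis using assms(2) by simp
qed

text \<open>Grouping the classes by their number of edges shows that the sum in (N3) is the total by
  which classes fall short of \<open>n - m\<close> edges. For \<open>n < m\<close> truncated
  subtraction agrees with the empty sum.\<close>

lemma sum_deficits_eq:
  "(\<Sum>i = 0..(int n - int m). real_of_int (int n - int m - i) * real (card (S_classes n k A (nat i))))
     = real (\<Sum>j<k. n - m - num_edges n (A j))"
proof (cases "n < m")
  case True
  then show ?thesis by simp
next
  case False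
  define d where "d = n - m"
  have d: "int n - int m = int d" using False by (simp add: d_def)
  have "(\<Sum>i = 0..int d. real_of_int (int d - i) * real (card (S_classes n k A (nat i))))
      = (\<Sum>i = 0..d. real (d - i) * real (card (S_classes n k A i)))"
    by (rule sum.reindex_bij_witness[of _ int nat]) (auto simp: of_nat_diff)
  also have "\<dots> = real (\<Sum>i = 0..d. (d - i) * card (S_classes n k A i))" by simp
  also have "(\<Sum>i = 0..d. (d - i) * card (S_classes n k A i))
      = (\<Sum>i = 0..d. \<Sum>j<k. if num_edges n (A j) = i then d - i else 0)"
  proof (intro sum.cong refl)
    fix i
    have "{j. j < k \<and> num_edges n (A j) = i} = {j \<in> {..<k}. num_edges n (A j) = i}" by auto
    then show "(d - i) * card (S_classes n k A i)
        = (\<Sum>j<k. if num_edges n (A j) = i then d - i else 0)"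
      by (simp add: S_classes_def sum.inter_filter[symmetric])
  qed
  also have "\<dots> = (\<Sum>j<k. \<Sum>i = 0..d. if num_edges n (A j) = i then d - i else 0)"
    by (rule sum.swap)
  also have "\<dots> = (\<Sum>j<k. d - num_edges n (A j))" by (intro sum.cong refl) simp
  finally show ?thesis unfolding d by (simp add: d_def)
qed

section \<open>Adding a vertex\<close>

text \<open>In a 2-factor on \<open>N\<close> vertices at most \<open>2 * (N - r)\<close> edges
  leave the first \<open>r\<close> vertices, so at least \<open>2 * r - N\<close> edges lie inside.
  This necessary bound is stated additively to avoid truncated subtraction.\<close>

definition near_factorization :: "nat \<Rightarrow> nat \<Rightarrow> nat \<Rightarrow> nat \<Rightarrow> (nat \<Rightarrow> nat \<Rightarrow> nat \<Rightarrow> nat) \<Rightarrow> bool" where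
  "near_factorization mu N k r G \<longleftrightarrow> decomposition mu r k G
     \<and> (\<forall>i<k. \<forall>u<r. degree {..<r} (G i) u \<le> 2) \<and> (\<forall>i<k. 2 * r \<le> num_edges r (G i) + N)"

text \<open>\<open>x i u\<close> is the number of edges of class \<open>i\<close> between
  \<open>u\<close> and the new vertex. Sharing the missing degrees evenly among the
  \<open>N - r\<close> missing vertices would give a fractional solution; \<open>x\<close> is an
  integral rounding of it.\<close>

lemma add_vertex_matrix:
  assumes G: "near_factorization mu N k r G" and k: "2 * k = mu * (N - 1)"
    and r: "0 < r" "r < N"
  shows "\<exists>x. (\<forall>i<k. \<forall>u<r. degree {..<r} (G i) u + x i u \<le> 2) \<and> (\<forall>i<k. (\<Sum>u<r. x i u) \<le> 2)
    \<and> (\<forall>i<k. 2 * Suc r \<le> num_edges r (G i) + N + (\<Sum>u<r. x i u)) \<and> (\<forall>u<r. (\<Sum>i<k. x i u) = mu)"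
proof -
  define q where "q = N - r"
  have q: "q > 0" "N = r + q" using r by (auto simp: q_def)
  have dec: "decomposition mu r k G" and deg: "\<And>i u. i < k \<Longrightarrow> u < r \<Longrightarrow> degree {..<r} (G i) u \<le> 2"
    and edges: "\<And>i. i < k \<Longrightarrow> 2 * r \<le> num_edges r (G i) + N"
    using G by (auto simp: near_factorization_def)
  text \<open>In a 2-factorization of \<open>mu K_N\<close> extending \<open>G\<close>, class \<open>i\<close> has \<open>l i\<close> edges among the
    \<open>q\<close> missing vertices; column \<open>r\<close> stands for the missing vertices other than the new one.\<close>
  define l where "l i = num_edges r (G i) + N - 2 * r" for i
  define c where "c i u = (if u < r then 2 - degree {..<r} (G i) u else 2 * l i)" for i u
  \<comment> \<open>With \<open>e\<close> edges in class \<open>i\<close>, the missing degrees sum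
    to \<open>2 * r - 2 * e\<close> and \<open>2 * l i\<close> is
    \<open>2 * (e + N - 2 * r)\<close>, so \<open>e\<close> cancels.\<close>
  have row: "(\<Sum>u\<le>r. c i u) = 2 * q" if i: "i < k" for i
  proof -
    have "(\<Sum>u<r. 2 - degree {..<r} (G i) u) + (\<Sum>u<r. degree {..<r} (G i) u) = (\<Sum>u<r. 2)"
      using deg[OF i] by (subst sum.distrib[symmetric], intro sum.cong) auto
    moreover have "(\<Sum>u<r. degree {..<r} (G i) u) = 2 * num_edges r (G i)"
      using dec i by (intro sum_degrees) (auto simp: decomposition_def)
    moreover have "(\<Sum>u\<le>r. c i u) = (\<Sum>u<r. 2 - degree {..<r} (G i) u) + 2 * l i"
      by (simp add: c_def lessThan_Suc_atMost[symmetric])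
    ultimately show ?thesis using edges[OF i] q by (simp add: l_def)
  qed
  have col: "(\<Sum>i<k. c i u) = q * mu" if u: "u < r" for u
  proof -
    have "(\<Sum>i<k. 2 - degree {..<r} (G i) u) + (\<Sum>i<k. degree {..<r} (G i) u) = (\<Sum>i<k. 2)"
      using deg u by (subst sum.distrib[symmetric], intro sum.cong) auto
    then have "(\<Sum>i<k. c i u) + mu * (r - 1) = mu * (N - 1)"
      using sum_degree_decomposition[OF dec u] k u by (simp add: c_def)
    moreover have "mu * (N - 1) = q * mu + mu * (r - 1)"
      using r q by (cases r) (auto simp: algebra_simps)
    ultimately show ?thesis by simp
  qed
  \<comment> \<open>The last column is the total \<open>q * mu * (N - 1)\<close> minus the
    \<open>r\<close> columns of sum \<open>q * mu\<close>.\<close>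
  have colr: "(\<Sum>i<k. c i r) = q * (mu * (q - 1))"
  proof -
    have "(\<Sum>i<k. \<Sum>u\<le>r. c i u) = (\<Sum>u\<le>r. \<Sum>i<k. c i u)" by (rule sum.swap)
    also have "\<dots> = (\<Sum>u<r. q * mu) + (\<Sum>i<k. c i r)"
      using col by (simp add: lessThan_Suc_atMost[symmetric])
    finally have "(\<Sum>i<k. \<Sum>u\<le>r. c i u) = r * q * mu + (\<Sum>i<k. c i r)" by simp
    moreover have "(\<Sum>i<k. \<Sum>u\<le>r. c i u) = q * (mu * (N - 1))" using row k by simp
    moreover have "q * (mu * (N - 1)) = r * q * mu + q * (mu * (q - 1))"
      using q by (cases q) (auto simp: algebra_simps)
    ultimately show ?thesis by simp
  qed
  define b where "b u = (if u < r then mu else mu * (q - 1))" for u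
  have "(\<Sum>i<k. c i u) = q * b u" if "u \<in> {..r}" for u
    using that col[of u] colr by (cases "u = r") (auto simp: b_def)
  then have "\<exists>x. (\<forall>i<k. (\<Sum>u\<in>{..r}. x i u) = 2) \<and> (\<forall>u\<in>{..r}. (\<Sum>i<k. x i u) = b u)
      \<and> (\<forall>i<k. \<forall>u\<in>{..r}. x i u \<le> c i u) \<and> (\<forall>i<k. c i r \<le> q \<longrightarrow> x i r \<le> (1::nat))"
    using q(1) row by (intro two_regular_submatrix) auto
  then obtain x where x: "\<forall>i<k. (\<Sum>u\<in>{..r}. x i u) = 2" "\<forall>u\<in>{..r}. (\<Sum>i<k. x i u) = b u"
      "\<forall>i<k. \<forall>u\<in>{..r}. x i u \<le> c i u" "\<forall>i<k. c i r \<le> q \<longrightarrow> x i r \<le> 1"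
    by blast
  have sum2: "(\<Sum>u<r. x i u) + x i r = 2" if "i < k" for i
    using x(1) that by (simp add: lessThan_Suc_atMost[symmetric])
  \<comment> \<open>This is exactly the edge bound for \<open>Suc r\<close>, since class
    \<open>i\<close> gains \<open>2 - x i r\<close> edges. Domination by \<open>c\<close> gives only
    \<open>2 * l i\<close>, which does not settle \<open>l i = 1\<close>.\<close>
  have xl: "x i r \<le> l i" if i: "i < k" for i
  proof -
    consider "l i = 0" | "l i = 1" | "l i \<ge> 2" by linarith
    then show ?thesis
    proof cases
      case 1
      then show ?thesis using x(3)[rule_format, OF i, of r] by (simp add: c_def)
    next
      case 2
      \<comment> \<open>For \<open>q = 1\<close> the whole last column is 0, so
        \<open>l i = 1\<close> forces \<open>q\<close> to be at least 2 and the bound 1 on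
        \<open>x i r\<close> applies.\<close>
      have "c i r \<le> (\<Sum>i<k. c i r)" using i by (intro member_le_sum) auto
      then have "q \<noteq> 1" using colr 2 by (auto simp: c_def)
      then have "c i r \<le> q" using 2 q(1) by (simp add: c_def)
      then show ?thesis using x(4) i 2 by simp
    next
      case 3
      then show ?thesis using sum2[OF i] by simp
    qed
  qed
  have "degree {..<r} (G i) u + x i u \<le> 2" if "i < k" "u < r" for i u
    using x(3)[rule_format, of i u] deg[of i u] that by (simp add: c_def)
  moreover have "2 * Suc r \<le> num_edges r (G i) + N + (\<Sum>u<r. x i u)" if "i < k" for i
    using xl[OF that] sum2[OF that] edges[OF that] by (simp add: l_def)
  moreover have "(\<Sum>u<r. x i u) \<le> 2" if "i < k" for i using sum2[OF that] by simp
  moreover have "(\<Sum>i<k. x i u) = mu" if "u < r" for u using x(2)[rule_format, of u] that by (simp add: b_def)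
  ultimately show ?thesis by blast
qed

lemma add_vertex:
  assumes G: "near_factorization mu N k r G" and k: "2 * k = mu * (N - 1)"
    and r: "0 < r" "r < N"
  shows "\<exists>G'. near_factorization mu N k (Suc r) G' \<and> enclosed_in k G G'"
proof -
  obtain x where x: "\<And>i u. i < k \<Longrightarrow> u < r \<Longrightarrow> degree {..<r} (G i) u + x i u \<le> 2"
      "\<And>i. i < k \<Longrightarrow> (\<Sum>u<r. x i u) \<le> 2"
      "\<And>i. i < k \<Longrightarrow> 2 * Suc r \<le> num_edges r (G i) + N + (\<Sum>u<r. x i u)"
      "\<And>u. u < r \<Longrightarrow> (\<Sum>i<k. x i u) = mu"
    using add_vertex_matrix[OF assms] by auto
  define G' where "G' i u v = (if u = r \<and> v < r then x i v else if v = r \<and> u < r then x i u else G i u v)" for i u v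
  have dec: "decomposition mu r k G" using G by (auto simp: near_factorization_def)
  have mg: "multigraph_on {..<r} (G i)" if "i < k" for i
    using dec that by (auto simp: decomposition_def)
  have mg': "multigraph_on {..<Suc r} (G' i)" if "i < k" for i
    using mg[OF that] by (auto simp: multigraph_on_def G'_def)
  have "(\<Sum>i<k. G' i u v) = mu" if "u < Suc r" "v < Suc r" "u \<noteq> v" for u v
    using that x(4) dec by (auto simp: G'_def decomposition_def less_Suc_eq)
  then have "decomposition mu (Suc r) k G'" using mg' by (auto simp: decomposition_def)
  moreover have "degree {..<Suc r} (G' i) u \<le> 2" if "i < k" "u < Suc r" for i u
  proof (cases "u = r")
    case True
    have "G' i r r = 0" using mg'[OF that(1)] by (auto simp: multigraph_on_def)
    then show ?thesis using True x(2)[OF that(1)] by (simp add: degree_def G'_def)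
  next
    case False
    then have "degree {..<Suc r} (G' i) u = degree {..<r} (G i) u + x i u"
      using that by (simp add: degree_def G'_def)
    then show ?thesis using x(1) False that by simp
  qed
  moreover have "2 * Suc r \<le> num_edges (Suc r) (G' i) + N" if "i < k" for i
  proof -
    have "num_edges r (G' i) = num_edges r (G i)" by (intro num_edges_cong) (auto simp: G'_def)
    then have "num_edges (Suc r) (G' i) = num_edges r (G i) + (\<Sum>u<r. x i u)"
      by (simp add: num_edges_Suc G'_def)
    then show ?thesis using x(3)[OF that] by simp
  qed
  moreover have "enclosed_in k G G'"
    using mg by (auto simp: enclosed_in_def G'_def multigraph_on_def)
  ultimately show ?thesis unfolding near_factorization_def by blast
qed

lemma extend_near_factorization:
  assumes G: "near_factorization mu N k n G" and k: "2 * k = mu * (N - 1)"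
    and n: "0 < n" "n \<le> r" "r \<le> N"
  shows "\<exists>G'. near_factorization mu N k r G' \<and> enclosed_in k G G'"
  using n(2,3)
proof (induction r rule: dec_induct)
  case base
  then show ?case using G by (auto simp: enclosed_in_def)
next
  case (step r)
  then obtain G' where G': "near_factorization mu N k r G'" "enclosed_in k G G'" by auto
  obtain G'' where "near_factorization mu N k (Suc r) G''" "enclosed_in k G' G''"
    using add_vertex[OF G'(1) k] step n by auto
  then show ?case using G'(2) unfolding enclosed_in_def by (meson le_trans)
qed

text \<open>For \<open>r = N\<close> each class has at least \<open>N\<close> edges, hence degree
  sum at least \<open>2 * N\<close>; degrees bounded by 2 must then all equal 2.\<close>

lemma near_factorization_full:
  assumes "near_factorization mu N k N G"
  shows "two_factorization mu N k G"
proof -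
  have dec: "decomposition mu N k G" and deg: "\<And>i u. i < k \<Longrightarrow> u < N \<Longrightarrow> degree {..<N} (G i) u \<le> 2"
    and edges: "\<And>i. i < k \<Longrightarrow> N \<le> num_edges N (G i)"
    using assms by (auto simp: near_factorization_def)
  have mg: "multigraph_on {..<N} (G i)" if "i < k" for i
    using dec that by (auto simp: decomposition_def)
  have "degree {..<N} (G i) u = 2" if i: "i < k" and u: "u < N" for i u
  proof -
    have le: "(\<Sum>u<N. degree {..<N} (G i) u) \<le> (\<Sum>u<N. 2)" using deg[OF i] by (intro sum_mono) auto
    then have eq: "(\<Sum>u<N. degree {..<N} (G i) u) = (\<Sum>u<N. 2)"
      using sum_degrees[OF mg[OF i], of N] edges[OF i] by simp
    show ?thesis using sum_mono_inv[OF eq, of u] deg[OF i] u by simp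
  qed
  then show ?thesis using dec mg by (auto simp: two_factorization_def two_factor_def)
qed

section \<open>Distributing the additional edges\<close>

definition add_edge :: "nat \<Rightarrow> nat \<Rightarrow> (nat \<Rightarrow> nat \<Rightarrow> nat) \<Rightarrow> nat \<Rightarrow> nat \<Rightarrow> nat" where
  "add_edge a b H u v = H u v + (if {u, v} = {a, b} then 1 else 0)"

lemma multigraph_on_add_edge:
  assumes H: "multigraph_on V H" and ab: "a \<in> V" "b \<in> V" "a \<noteq> b"
  shows "multigraph_on V (add_edge a b H)"
  unfolding multigraph_on_def
proof (intro conjI allI impI)
  fix u v
  have "H u v = H v u" using H unfolding multigraph_on_def by blast
  then show "add_edge a b H u v = add_edge a b H v u"
    unfolding add_edge_def by (simp only: insert_commute[of u v])
  show "add_edge a b H u u = 0" using H ab(3) by (simp add: multigraph_on_def add_edge_def)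
  assume "u \<notin> V \<or> v \<notin> V"
  then have "H u v = 0" "{u, v} \<noteq> {a, b}"
    using H ab(1,2) unfolding multigraph_on_def doubleton_eq_iff by blast+
  then show "add_edge a b H u v = 0" by (simp add: add_edge_def)
qed

lemma degree_add_edge:
  assumes "a < n" "b < n" "a \<noteq> b"
  shows "degree {..<n} (add_edge a b H) u = degree {..<n} H u + (if u = a \<or> u = b then 1 else 0)"
proof -
  have "degree {..<n} (add_edge a b H) u = degree {..<n} H u + (\<Sum>v<n. if {u, v} = {a, b} then 1 else 0)"
    by (simp add: degree_def add_edge_def sum.distrib)
  \<comment> \<open>For fixed \<open>u\<close> only one \<open>v\<close> can complete the pair:
    \<open>b\<close> if \<open>u = a\<close>, otherwise \<open>a\<close>.\<close>
  also have "(\<Sum>v<n. if {u, v} = {a, b} then 1 else 0)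
      = (\<Sum>v<n. if v = (if u = a then b else a) then (if u = a \<or> u = b then 1 else 0) else 0)"
    using assms by (intro sum.cong) (auto simp: doubleton_eq_iff)
  finally show ?thesis using assms by simp
qed

lemma num_edges_add_edge:
  assumes "a < b" "b < n"
  shows "num_edges n (add_edge a b H) = Suc (num_edges n H)"
proof -
  have "num_edges n (add_edge a b H)
      = (\<Sum>u<n. \<Sum>v<n. (if u < v then H u v else 0) + (if v = b then (if u = a then 1 else 0) else 0))"
    unfolding num_edges_def add_edge_def using assms
    by (intro sum.cong refl) (auto simp: doubleton_eq_iff)
  also have "\<dots> = num_edges n H + 1" using assms by (simp add: sum.distrib num_edges_def)
  finally show ?thesis by simp
qed

lemma exists_free_class:
  assumes mg: "\<And>i. i < k \<Longrightarrow> multigraph_on {..<n} (G i)"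
    and le: "\<And>u v. u < n \<Longrightarrow> v < n \<Longrightarrow> (\<Sum>i<k. G i u v) \<le> mu"
    and ab: "a < n" "b < n" "a \<noteq> b" "(\<Sum>i<k. G i a b) < mu"
    and k: "2 * k = mu * (n + m - 1)" and nm: "n \<le> m + 2"
  shows "\<exists>i<k. degree {..<n} (G i) a \<le> 1 \<and> degree {..<n} (G i) b \<le> 1"
proof (rule ccontr)
  assume "\<not> ?thesis"
  then have full: "2 \<le> degree {..<n} (G i) a \<or> 2 \<le> degree {..<n} (G i) b" if "i < k" for i
    using that by force
  let ?p = "\<Sum>i<k. G i a b"
  have sym: "(\<Sum>i<k. G i b a) = ?p"
    using mg by (intro sum.cong refl multigraph_on_sym) auto
  \<comment> \<open>Loops contribute 0, the pair \<open>u\<close>, \<open>v\<close> its present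
    multiplicity, and each of the other \<open>n - 2\<close> vertices at most
    \<open>mu\<close>.\<close>
  have bound: "(\<Sum>i<k. degree {..<n} (G i) u) \<le> (\<Sum>i<k. G i u v) + mu * (n - 2)"
    if "u < n" "v < n" "u \<noteq> v" for u v
  proof -
    have "(\<Sum>i<k. degree {..<n} (G i) u) = (\<Sum>w<n. \<Sum>i<k. G i u w)"
      unfolding degree_def by (rule sum.swap)
    also have "\<dots> = (\<Sum>i<k. G i u u) + ((\<Sum>i<k. G i u v) + (\<Sum>w\<in>{..<n} - {u} - {v}. \<Sum>i<k. G i u w))"
      using that by (simp add: sum.remove[of "{..<n}" u] sum.remove[of "{..<n} - {u}" v])
    also have "(\<Sum>i<k. G i u u) = 0" using mg by (auto simp: multigraph_on_def)
    also have "(\<Sum>w\<in>{..<n} - {u} - {v}. \<Sum>i<k. G i u w) \<le> (\<Sum>w\<in>{..<n} - {u} - {v}. mu)"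
      using that le by (intro sum_mono) auto
    finally show ?thesis using that by (simp add: card_Diff_subset mult.commute numeral_2_eq_2)
  qed
  \<comment> \<open>One of \<open>a\<close>, \<open>b\<close> has degree at least 2 in class
    \<open>i\<close>, and the other has at least the \<open>G i a b\<close> edges joining
    them.\<close>
  have "(\<Sum>i<k. 2 + G i a b) \<le> (\<Sum>i<k. degree {..<n} (G i) a + degree {..<n} (G i) b)"
  proof (intro sum_mono)
    fix i assume "i \<in> {..<k}"
    then have i: "i < k" by simp
    have "G i a b \<le> degree {..<n} (G i) a" using ab by (intro mult_le_degree) auto
    moreover have "G i a b \<le> degree {..<n} (G i) b"
      using mult_le_degree[OF ab(1), of "G i" b] mg[OF i] by (simp add: multigraph_on_def)
    ultimately show "2 + G i a b \<le> degree {..<n} (G i) a + degree {..<n} (G i) b"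
      using full[OF i] by auto
  qed
  then have "2 * k + ?p \<le> 2 * ?p + 2 * (mu * (n - 2))"
    using bound[of a b] bound[of b a] ab sym unfolding sum.distrib by simp
  \<comment> \<open>Cancelling one \<open>?p\<close> leaves \<open>2 * k\<close> at most
    \<open>?p + 2 * mu * (n - 2)\<close>, and \<open>?p < mu\<close> makes the inequality
    strict.\<close>
  then have "mu * (n + m - 1) < mu * (2 * (n - 2) + 1)"
    using k ab(4) by (simp add: algebra_simps)
  then have "n + m - 1 < 2 * (n - 2) + 1" by (simp only: nat_mult_less_cancel_disj)
  then show False using nm ab(1-3) by arith
qed

text \<open>Induction on the number of edges still to be placed. Hypothesis \<open>def\<close> says
  that they suffice to bring every class up to \<open>n - m\<close> edges; it persists because each
  edge goes to a deficient class while there is one.\<close>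

lemma distribute_edges:
  assumes mg: "\<And>i. i < k \<Longrightarrow> multigraph_on {..<n} (G i)"
    and le: "\<And>u v. u < n \<Longrightarrow> v < n \<Longrightarrow> (\<Sum>i<k. G i u v) \<le> mu"
    and deg: "\<And>i u. i < k \<Longrightarrow> u < n \<Longrightarrow> degree {..<n} (G i) u \<le> 2"
    and def: "(\<Sum>i<k. n - m - num_edges n (G i)) \<le> num_edges n (\<lambda>u v. mu - (\<Sum>i<k. G i u v))"
    and k: "2 * k = mu * (n + m - 1)" and nm: "n \<le> m + 2"
  shows "\<exists>G'. near_factorization mu (n + m) k n G' \<and> enclosed_in k G G'"
  using mg le deg def
proof (induction "num_edges n (\<lambda>u v. mu - (\<Sum>i<k. G i u v))" arbitrary: G)
  case 0
  note mg = 0(2) and le = 0(3) and deg = 0(4)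
  have lt: "(\<Sum>i<k. G i u v) = mu" if "u < v" "v < n" for u v
  proof -
    have "\<forall>a\<in>{..<n}. \<forall>b\<in>{..<n}. (if a < b then mu - (\<Sum>i<k. G i a b) else 0) = 0"
      using 0(1) unfolding num_edges_def by (simp del: diff_is_0_eq)
    from this[rule_format, of u v] have "mu - (\<Sum>i<k. G i u v) = 0" using that by simp
    then show ?thesis using le[of u v] that by simp
  qed
  have "(\<Sum>i<k. G i u v) = mu" if "u < n" "v < n" "u \<noteq> v" for u v
  proof (cases "u < v")
    case False
    have "(\<Sum>i<k. G i u v) = (\<Sum>i<k. G i v u)"
      using mg by (intro sum.cong refl multigraph_on_sym) auto
    then show ?thesis using False that lt[of v u] by simp
  qed (use lt that in simp)
  moreover have "2 * n \<le> num_edges n (G i) + (n + m)" if "i < k" for i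
  proof -
    have "n - m - num_edges n (G i) = 0" using 0(1,5) that by simp
    then show ?thesis by simp
  qed
  ultimately have "near_factorization mu (n + m) k n G"
    using mg deg by (auto simp: near_factorization_def decomposition_def)
  then show ?case by (auto simp: enclosed_in_def)
next
  case (Suc R)
  note mg = Suc.prems(1) and le = Suc.prems(2) and deg = Suc.prems(3) and def = Suc.prems(4)
  have "num_edges n (\<lambda>u v. mu - (\<Sum>i<k. G i u v)) \<noteq> 0" using Suc.hyps(2) by simp
  then obtain a b where ab: "a < b" "b < n" "(\<Sum>i<k. G i a b) < mu"
    unfolding num_edges_def by (auto split: if_splits)
  let ?D = "\<lambda>G. \<Sum>i<k. n - m - num_edges n (G i)"
  have "\<exists>j<k. degree {..<n} (G j) a \<le> 1 \<and> degree {..<n} (G j) b \<le> 1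
      \<and> (?D G = 0 \<or> num_edges n (G j) < n - m)"
  proof (cases "?D G = 0")
    case True
    then show ?thesis using exists_free_class[OF mg le, of a b m] ab k nm by auto
  next
    case False
    then obtain j where j: "j < k" "num_edges n (G j) < n - m" by auto
    \<comment> \<open>As \<open>n - m\<close> is at most 2, a deficient class has at most one edge
      and hence no vertex of degree 2.\<close>
    then have "num_edges n (G j) \<le> 1" using nm by linarith
    then have "degree {..<n} (G j) a \<le> 1" "degree {..<n} (G j) b \<le> 1"
      using degree_le_num_edges[OF mg[OF j(1)], of _ n] ab by (meson le_trans less_trans)+
    then show ?thesis using j by blast
  qed
  then obtain j where j: "j < k" "degree {..<n} (G j) a \<le> 1" "degree {..<n} (G j) b \<le> 1"
      "?D G = 0 \<or> num_edges n (G j) < n - m" by blast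
  define G' where "G' = G(j := add_edge a b (G j))"
  have sumG': "(\<Sum>i<k. G' i u v) = add_edge a b (\<lambda>u v. \<Sum>i<k. G i u v) u v" for u v
    using j(1) by (simp add: G'_def sum.remove[of "{..<k}" j] add_edge_def)
  have sym: "(\<Sum>i<k. G i u v) = (\<Sum>i<k. G i v u)" for u v
    using mg by (intro sum.cong refl multigraph_on_sym) auto
  \<comment> \<open>Returning \<open>ab\<close> to the new graph of missing edges restores the old
    one.\<close>
  have R: "Suc (num_edges n (\<lambda>u v. mu - (\<Sum>i<k. G' i u v))) = Suc R"
    unfolding Suc.hyps(2) num_edges_add_edge[OF ab(1,2), symmetric]
    using ab by (intro num_edges_cong) (auto simp: sumG' add_edge_def doubleton_eq_iff)
  have D: "?D G' \<le> ?D G - 1"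
  proof (cases "?D G = 0")
    case True
    have "num_edges n (G i) \<le> num_edges n (G' i)" for i
      using ab by (simp add: G'_def num_edges_add_edge)
    then have "?D G' \<le> ?D G" by (intro sum_mono diff_le_mono2)
    then show ?thesis using True by linarith
  next
    case False
    then have "num_edges n (G j) < n - m" using j(4) by metis
    then show ?thesis
      using j(1) ab by (simp add: G'_def sum.remove[of "{..<k}" j] num_edges_add_edge)
  qed
  have "\<exists>G''. near_factorization mu (n + m) k n G'' \<and> enclosed_in k G' G''"
  proof (rule Suc.hyps(1))
    show "R = num_edges n (\<lambda>u v. mu - (\<Sum>i<k. G' i u v))" using R by simp
    show "multigraph_on {..<n} (G' i)" if "i < k" for i
      using mg that ab by (simp add: G'_def multigraph_on_add_edge)
    show "(\<Sum>i<k. G' i u v) \<le> mu" if "u < n" "v < n" for u v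
      using le[OF that] ab sym[of u v] by (auto simp: sumG' add_edge_def doubleton_eq_iff)
    show "degree {..<n} (G' i) u \<le> 2" if "i < k" "u < n" for i u
      using deg[OF that] j ab by (auto simp: G'_def degree_add_edge)
    show "?D G' \<le> num_edges n (\<lambda>u v. mu - (\<Sum>i<k. G' i u v))" using D def R Suc.hyps(2) by simp
  qed
  moreover have "enclosed_in k G G'" by (auto simp: enclosed_in_def G'_def add_edge_def)
  ultimately show ?case unfolding enclosed_in_def by (meson le_trans)
qed

section \<open>Degrees in unions of paths and cycles\<close>

text \<open>Index \<open>i\<close> stands for an edge from \<open>f i\<close> to \<open>g i\<close>.
  Different \<open>v\<close> give disjoint index sets, so the sum counts indices with
  \<open>f i = u\<close> or \<open>g i = u\<close>, at most one of each by injectivity.\<close>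

lemma sum_card_doubletons_le:
  fixes f g :: "nat \<Rightarrow> nat"
  assumes I: "finite I" and V: "finite V" and inj: "inj_on f I" "inj_on g I"
    and S: "f ` I \<subseteq> S" "g ` I \<subseteq> S"
  shows "(\<Sum>v\<in>V. card {i \<in> I. {f i, g i} = {u, v}}) \<le> (if u \<in> S then 2 else 0)"
proof -
  have "(\<Sum>v\<in>V. card {i \<in> I. {f i, g i} = {u, v}}) = card (\<Union>v\<in>V. {i \<in> I. {f i, g i} = {u, v}})"
    using I V by (subst card_UN_disjoint) (auto simp: doubleton_eq_iff)
  also have "\<dots> \<le> card ({i \<in> I. f i = u} \<union> {i \<in> I. g i = u})"
    using I by (intro card_mono) (auto simp: doubleton_eq_iff)
  also have "\<dots> \<le> card {i \<in> I. f i = u} + card {i \<in> I. g i = u}" by (rule card_Un_le)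
  also have "\<dots> \<le> (if u \<in> S then 2 else 0)"
  proof -
    have "card {i \<in> I. f i = u} \<le> 1" "card {i \<in> I. g i = u} \<le> 1"
      using inj I by (auto simp: card_le_Suc0_iff_eq inj_on_def)
    moreover have "card {i \<in> I. f i = u} = 0" "card {i \<in> I. g i = u} = 0" if "u \<notin> S"
      using S that I by auto
    ultimately show ?thesis by (cases "u \<in> S") simp_all
  qed
  finally show ?thesis .
qed

text \<open>The bound 0 off the component is what allows the bounds of disjoint components to be
  added.\<close>

lemma sum_comp_mult_le:
  assumes "distinct (snd c)" "finite V"
  shows "(\<Sum>v\<in>V. comp_mult c u v) \<le> (if u \<in> set (snd c) then 2 else 0)"
proof -
  define cs where "cs = snd c"
  have d: "distinct cs" using assms by (simp add: cs_def)
  show ?thesis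
  proof (cases "fst c")
    case True
    \<comment> \<open>The cyclic successor permutes the indices, and distinct indices carry distinct
      vertices.\<close>
    have inj: "inj_on (\<lambda>i. cs ! (Suc i mod length cs)) {..<length cs}"
    proof (rule inj_onI)
      fix i j
      assume ij: "i \<in> {..<length cs}" "j \<in> {..<length cs}"
        "cs ! (Suc i mod length cs) = cs ! (Suc j mod length cs)"
      then have "Suc i mod length cs = Suc j mod length cs"
        using nth_eq_iff_index_eq[OF d] by (metis lessThan_iff mod_less_divisor not_less_zero gr0I)
      then show "i = j" using ij by (auto simp: mod_Suc split: if_splits)
    qed
    have "(\<Sum>v\<in>V. card {i \<in> {..<length cs}. {cs ! i, cs ! (Suc i mod length cs)} = {u, v}})
        \<le> (if u \<in> set cs then 2 else 0)"
    proof (rule sum_card_doubletons_le[OF _ assms(2) _ inj])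
      show "(\<lambda>i. cs ! (Suc i mod length cs)) ` {..<length cs} \<subseteq> set cs"
        by (auto intro!: nth_mem mod_less_divisor)
    qed (use d in \<open>auto intro: inj_on_nth\<close>)
    then show ?thesis using True by (simp add: comp_mult_def cycle_mult_def cs_def)
  next
    case False
    have "(\<Sum>v\<in>V. card {i \<in> {i. Suc i < length cs}. {cs ! i, cs ! Suc i} = {u, v}})
        \<le> (if u \<in> set cs then 2 else 0)"
    proof (rule sum_card_doubletons_le[OF _ assms(2)])
      show "finite {i. Suc i < length cs}" by (rule finite_subset[of _ "{..<length cs}"]) auto
    qed (use d in \<open>auto simp: inj_on_def nth_eq_iff_index_eq\<close>)
    then show ?thesis using False by (simp add: comp_mult_def path_mult_def cs_def)
  qed
qed

lemma path_cycle_union_degree_le: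
  assumes "path_cycle_union V H" "finite W"
  shows "degree W H u \<le> 2"
proof -
  obtain Cs where Cs: "distinct (concat (map snd Cs))" "\<And>u v. H u v = (\<Sum>c\<leftarrow>Cs. comp_mult c u v)"
    using assms(1) unfolding path_cycle_union_def by blast
  have "(\<Sum>v\<in>W. \<Sum>c\<leftarrow>Cs. comp_mult c u v) \<le> (if u \<in> set (concat (map snd Cs)) then 2 else 0)"
    using Cs(1)
  proof (induction Cs)
    case Nil
    then show ?case by simp
  next
    case (Cons c Cs)
    have "(\<Sum>v\<in>W. comp_mult c u v) \<le> (if u \<in> set (snd c) then 2 else 0)"
      using Cons.prems assms(2) by (intro sum_comp_mult_le) auto
    moreover have "(\<Sum>v\<in>W. \<Sum>c\<leftarrow>Cs. comp_mult c u v) \<le> (if u \<in> set (concat (map snd Cs)) then 2 else 0)"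
      using Cons by simp
    moreover have "u \<notin> set (snd c) \<or> u \<notin> set (concat (map snd Cs))"
      using Cons.prems by auto
    ultimately show ?case by (auto simp: sum.distrib split: if_splits)
  qed
  then show ?thesis by (simp add: degree_def Cs(2) split: if_splits)
qed

section \<open>Necessity\<close>

text \<open>Count the edges at vertex 0: two in each class, and \<open>mu\<close> to each of the
  other \<open>N - 1\<close> vertices.\<close>

lemma two_factorization_size:
  assumes "two_factorization mu N k H" "0 < N"
  shows "2 * k = mu * (N - 1)"
proof -
  have "(\<Sum>i<k. degree {..<N} (H i) 0) = (\<Sum>i<k. 2)"
    using assms by (intro sum.cong) (auto simp: two_factorization_def two_factor_def)
  then show ?thesis
    using sum_degree_decomposition[of mu N k H 0] assms by (auto simp: two_factorization_def)
qed

lemma degree_split: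
  "degree {..<n + m} H u = degree {..<n} H u + degree {n..<n + m} H u" for n m :: nat
proof -
  have eq: "{..<n + m} = {..<n} \<union> {n..<n + m}" by auto
  show ?thesis unfolding degree_def eq by (rule sum.union_disjoint) auto
qed

text \<open>In a class that is already a 2-factor, no edge joins old and new vertices, so the new
  vertex \<open>n\<close> has both its edges among the new vertices. Only
  \<open>mu * (m - 1)\<close> such edges exist at \<open>n\<close>.\<close>

lemma two_factor_classes_bound:
  assumes H: "two_factorization mu (n + m) k H" and enc: "enclosed_in k A H" and m: "0 < m"
  shows "2 * card {j. j < k \<and> two_factor {..<n} (A j)} \<le> mu * (m - 1)"
proof -
  let ?F = "{j. j < k \<and> two_factor {..<n} (A j)}"
  have dec: "decomposition mu (n + m) k H" using H by (simp add: two_factorization_def)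
  have tf: "degree {..<n + m} (H j) u = 2" if "j < k" "u < n + m" for j u
    using H that by (auto simp: two_factorization_def two_factor_def)
  have mg: "multigraph_on {..<n + m} (H j)" if "j < k" for j
    using dec that by (auto simp: decomposition_def)
  have new: "degree {n..<n + m} (H j) n = 2" if j: "j \<in> ?F" for j
  proof -
    have "H j n u = 0" if u: "u < n" for u
    proof -
      have "degree {..<n} (A j) u \<le> degree {..<n} (H j) u"
        using enc j unfolding degree_def enclosed_in_def by (intro sum_mono) auto
      then have "degree {n..<n + m} (H j) u = 0"
        using j u tf[of j u] by (simp add: degree_split two_factor_def)
      then have "H j u n = 0" using m by (simp add: degree_def)
      moreover have "H j n u = H j u n" using j by (intro multigraph_on_sym[OF mg]) simp
      ultimately show ?thesis by simp
    qed
    then have "degree {..<n} (H j) n = 0" by (simp add: degree_def)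
    then show ?thesis using tf[of j n] j m by (simp add: degree_split)
  qed
  have "2 * card ?F = (\<Sum>j\<in>?F. degree {n..<n + m} (H j) n)" using new by simp
  also have "\<dots> \<le> (\<Sum>j<k. degree {n..<n + m} (H j) n)" by (intro sum_mono2) auto
  also have "\<dots> = (\<Sum>v\<in>{n..<n + m}. \<Sum>j<k. H j n v)" unfolding degree_def by (rule sum.swap)
  also have "\<dots> = (\<Sum>v\<in>{n..<n + m} - {n}. \<Sum>j<k. H j n v)"
    using m by (subst sum.remove[of _ n]) (auto simp: multigraph_on_loop[OF mg])
  also have "\<dots> = (\<Sum>v\<in>{n..<n + m} - {n}. mu)"
    using dec m by (intro sum.cong) (auto simp: decomposition_def)
  also have "\<dots> = mu * (m - 1)" using m by simp
  finally show ?thesis .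
qed

text \<open>The degree sum \<open>2 * n\<close> of the first \<open>n\<close> vertices is twice the
  number of inner edges plus the crossing edges, and the other \<open>m\<close> vertices meet at
  most \<open>2 * m\<close> of these.\<close>

lemma two_factor_restriction_edges:
  assumes H: "two_factor {..<n + m} H"
  shows "n \<le> num_edges n H + m"
proof -
  have mg: "multigraph_on {..<n + m} H" and deg: "\<And>u. u < n + m \<Longrightarrow> degree {..<n + m} H u = 2"
    using H by (auto simp: two_factor_def)
  have "2 * n = (\<Sum>u<n. degree {..<n + m} H u)" using deg by simp
  also have "\<dots> = 2 * num_edges n H + (\<Sum>u<n. \<Sum>v\<in>{n..<n + m}. H u v)"
    unfolding degree_split sum.distrib sum_degrees[OF mg] by (simp add: degree_def)
  also have "(\<Sum>u<n. \<Sum>v\<in>{n..<n + m}. H u v) = (\<Sum>v\<in>{n..<n + m}. \<Sum>u<n. H v u)"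
    by (subst sum.swap) (simp only: multigraph_on_sym[OF mg])
  also have "\<dots> \<le> (\<Sum>v\<in>{n..<n + m}. degree {..<n + m} H v)"
    unfolding degree_def by (intro sum_mono sum_mono2) auto
  also have "\<dots> = 2 * m" using deg by simp
  finally show ?thesis by simp
qed

lemma deficits_bound:
  assumes A: "decomposition lam n k A" and H: "two_factorization mu (n + m) k H"
    and enc: "enclosed_in k A H"
  shows "2 * (\<Sum>j<k. n - m - num_edges n (A j)) + lam * (n * (n - 1)) \<le> mu * (n * (n - 1))"
proof -
  \<comment> \<open>With truncated subtraction each summand on the left is the maximum of
    \<open>n - m\<close> and the edge count of \<open>A j\<close>; both bound the edge count of
    \<open>H j\<close> from below.\<close>
  have "(\<Sum>j<k. (n - m - num_edges n (A j)) + num_edges n (A j)) \<le> (\<Sum>j<k. num_edges n (H j))"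
  proof (intro sum_mono)
    fix j assume "j \<in> {..<k}"
    then have j: "j < k" by simp
    have "n \<le> num_edges n (H j) + m"
      using H j by (intro two_factor_restriction_edges) (auto simp: two_factorization_def)
    moreover have "num_edges n (A j) \<le> num_edges n (H j)"
      using enc j by (intro num_edges_mono) (auto simp: enclosed_in_def)
    ultimately show "(n - m - num_edges n (A j)) + num_edges n (A j) \<le> num_edges n (H j)" by simp
  qed
  moreover have "2 * (\<Sum>j<k. num_edges n (H j)) = mu * (n * (n - 1))"
  proof -
    have "num_edges n (\<lambda>u v. \<Sum>i<k. H i u v) = num_edges n (\<lambda>u v. mu)"
      using H unfolding two_factorization_def decomposition_def by (intro num_edges_cong) auto
    then show ?thesis using num_edges_const[of n mu] by (simp add: num_edges_sum)
  qed
  ultimately show ?thesis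
    using num_edges_decomposition[OF A] by (simp add: sum.distrib)
qed

section \<open>Both directions, with (N1) and (N3) over the natural numbers\<close>

theorem theorem2:
  fixes n m mu lam k :: nat and A :: "nat \<Rightarrow> nat \<Rightarrow> nat \<Rightarrow> nat"
  assumes "0 < n" "0 < m" "0 < mu" "0 < lam" "0 < k"
    and "mu > lam" and "int m \<ge> int n - 2"
    and "path_decomposition lam n k A"
  shows "(\<exists>H. two_factorization mu (n + m) k H \<and> enclosed_in k A H) \<longleftrightarrow>
    (real k = real mu * (real m + real n - 1) / 2
     \<and> real (card {j. j < k \<and> two_factor {..<n} (A j)}) \<le> real mu * (real m - 1) / 2
     \<and> (\<Sum>i = 0..(int n - int m). real_of_int (int n - int m - i) * real (card (S_classes n k A (nat i))))
         \<le> real (mu - lam) * (real n * (real n - 1) / 2))"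
proof -
  let ?D = "\<Sum>j<k. n - m - num_edges n (A j)"
  have A: "decomposition lam n k A" and pcu: "\<And>i. i < k \<Longrightarrow> path_cycle_union {..<n} (A i)"
    using assms(8) by (auto simp: path_decomposition_def)
  have mg: "multigraph_on {..<n} (A i)" if "i < k" for i
    using A that by (auto simp: decomposition_def)
  have size: "real k = real mu * (real m + real n - 1) / 2 \<longleftrightarrow> 2 * k = mu * (n + m - 1)"
  proof -
    have "real mu * (real m + real n - 1) = real (mu * (n + m - 1))"
      using assms(1) by (simp add: of_nat_diff)
    moreover have "real k = x / 2 \<longleftrightarrow> real (2 * k) = x" for x by auto
    ultimately show ?thesis by (simp only: of_nat_eq_iff)
  qed
  have deficits: "real ?D \<le> real (mu - lam) * (real n * (real n - 1) / 2)
      \<longleftrightarrow> 2 * ?D \<le> (mu - lam) * (n * (n - 1))"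
  proof -
    have "real (mu - lam) * (real n * (real n - 1) / 2) = real ((mu - lam) * (n * (n - 1))) / 2"
      using assms(1) by (simp add: of_nat_diff)
    moreover have "real ?D \<le> x / 2 \<longleftrightarrow> real (2 * ?D) \<le> x" for x by auto
    ultimately show ?thesis by (simp only: of_nat_le_iff)
  qed
  show ?thesis
    unfolding sum_deficits_eq size deficits
  proof (intro iffI conjI)
    assume "\<exists>H. two_factorization mu (n + m) k H \<and> enclosed_in k A H"
    then obtain H where H: "two_factorization mu (n + m) k H" "enclosed_in k A H" by blast
    show "2 * k = mu * (n + m - 1)" using two_factorization_size[OF H(1)] assms(1) by simp
    have "real (2 * card {j. j < k \<and> two_factor {..<n} (A j)}) \<le> real (mu * (m - 1))"
      using two_factor_classes_bound[OF H assms(2)] by (simp only: of_nat_le_iff)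
    then show "real (card {j. j < k \<and> two_factor {..<n} (A j)}) \<le> real mu * (real m - 1) / 2"
      using assms(2) by (simp add: of_nat_diff)
    show "2 * ?D \<le> (mu - lam) * (n * (n - 1))"
      using deficits_bound[OF A H] by (simp add: diff_mult_distrib)
  next
    assume "2 * k = mu * (n + m - 1) \<and>
      real (card {j. j < k \<and> two_factor {..<n} (A j)}) \<le> real mu * (real m - 1) / 2 \<and>
      2 * ?D \<le> (mu - lam) * (n * (n - 1))"
    then have k: "2 * k = mu * (n + m - 1)" and D: "2 * ?D \<le> (mu - lam) * (n * (n - 1))" by auto
    \<comment> \<open>Every pair still lacks \<open>mu - lam\<close> edges, so (N3) is the supply
      condition for distributing them.\<close>
    have "num_edges n (\<lambda>u v. mu - (\<Sum>i<k. A i u v)) = num_edges n (\<lambda>u v. mu - lam)"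
      using A by (intro num_edges_cong) (auto simp: decomposition_def)
    then have D': "?D \<le> num_edges n (\<lambda>u v. mu - (\<Sum>i<k. A i u v))"
      using D num_edges_const[of n "mu - lam"] by simp
    have le: "(\<Sum>i<k. A i u v) \<le> mu" if "u < n" "v < n" for u v
    proof (cases "u = v")
      case True
      then show ?thesis using mg by (simp add: multigraph_on_def)
    next
      case False
      then show ?thesis using A that assms(6) by (simp add: decomposition_def)
    qed
    have deg: "degree {..<n} (A i) u \<le> 2" if "i < k" for i u
      using path_cycle_union_degree_le[OF pcu[OF that]] by simp
    obtain G where G: "near_factorization mu (n + m) k n G" "enclosed_in k A G"
      using distribute_edges[OF mg le deg D' k] assms(7) by auto
    obtain H where H: "near_factorization mu (n + m) k (n + m) H" "enclosed_in k G H"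
      using extend_near_factorization[OF G(1) k assms(1), of "n + m"] by auto
    have "enclosed_in k A H" using G(2) H(2) unfolding enclosed_in_def by (meson le_trans)
    then show "\<exists>H. two_factorization mu (n + m) k H \<and> enclosed_in k A H"
      using near_factorization_full[OF H(1)] by blast
  qed
qed

end
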